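(* Let $(p\colon \mathbb{E}\to\mathbb{B}, O, \Omega)$ be a $\mathbf{CLat}_\sqcap$-fibration with truth values indexed by a discrete category $A$, let $F\colon\mathbb{B}\to\mathbb{B}$ with modality $\tau\colon F\circ O\Rightarrow O$, and let $(T,\lambda)$ be an $N$-ary one-step composition operation for $F$-coalgebras. Then a modality $\sigma\colon T\circ\langle O,\dots,O\rangle\Rightarrow O$ lifts $\lambda$ along $p$ if the following two conditions hold: (1) for each $a\in A$, $\sigma_a\circ T(\tau_a,\dots,\tau_a)=\tau_a\circ F\sigma_a\circ\lambda_{(O(a),\dots,O(a))}$ (equivalently, $\lambda$ is a 2-cell $(T,\sigma)\circ(F^N,\tau^N)\Rightarrow(F,\tau)\circ(T,\sigma)$ in the lax coslice 2-category under $A$); (2) for all $P_1,\dots,P_N\in\mathbb{E}$, $$\bigwedge_{a\in A,\ k_i\in\mathbb{E}(P_i,\Omega(a))}\bigl(\tau_a\circ F(\sigma_a\circ T(pk_1,\dots,pk_N))\bigr)^*\Omega(a)\;=\;F^{\Omega}_{\tau}\bigl(T^{\Omega}_{\sigma}(P_1,\dots,P_N)\bigr),$$ i.e. $R^{\Omega}_{p}\circ\mathrm{Sp}^A(F,\tau)\circ\mathrm{Sp}^A(T,\sigma)\circ L^{\Omega^N}_{p^N}=F^{\Omega}_{\tau}\circ T^{\Omega}_{\sigma}$.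
   Context: A $\mathbf{CLat}_\sqcap$-fibration is a posetal fibration $p\colon\mathbb{E}\to\mathbb{B}$ whose fibers $\mathbb{E}_X$ are complete lattices (order $\sqsubseteq$, meet written $\bigwedge$) and whose reindexing maps $f^*$ preserve all meets. A $\mathbf{CLat}_\sqcap$-fibration with truth values is a tuple $(p, O\colon A\to\mathbb{B}, \Omega\colon A\to\mathbb{E})$ with $A$ discrete and $O=p\circ\Omega$. A morphism $f\colon pP\to pQ$ underlies an $\mathbb{E}$-morphism $P\to Q$ iff $P\sqsubseteq f^*Q$. The codensity lifting of $F$ is $F^{\Omega}_{\tau}(P)=\bigwedge_{a\in A,\,k\in\mathbb{E}(P,\Omega(a))}(\tau_a\circ F(pk))^*\Omega(a)$, and the $N$-codensity lifting of $T\colon\mathbb{B}^N\to\mathbb{B}$ is $T^{\Omega}_{\sigma}(P_1,\dots,P_N)=\bigwedge_{a\in A,\,k_i\in\mathbb{E}(P_i,\Omega(a))}(\sigma_a\circ T(pk_1,\dots,pk_N))^*\Omega(a)$. An $N$-ary one-step composition operation is a functor $T\colon\mathbb{B}^N\to\mathbb{B}$ with a natural transformation $\lambda\colon T\circ F^N\Rightarrow F\circ T$. "$\sigma$ lifts $\lambda$ along $p$" means that for all $P_1,\dots,P_N\in\mathbb{E}$, $T^{\Omega}_{\sigma}(F^{\Omega}_{\tau}P_1,\dots,F^{\Omega}_{\tau}P_N)\sqsubseteq\lambda^*\,F^{\Omega}_{\tau}(T^{\Omega}_{\sigma}(P_1,\dots,P_N))$. In condition (2), $\mathrm{Sp}^A(\mathbb{B},O)$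 is the category of pairs $(X,S)$ with $S(a)\subseteq\mathbb{B}(X,O(a))$; $L^{\Omega}_p(P)=(pP,\,a\mapsto\{pk\mid k\in\mathbb{E}(P,\Omega(a))\})$, $R^{\Omega}_p(X,S)=\bigwedge_{a,\,k\in S(a)}k^*\Omega(a)$, $\mathrm{Sp}^A(F,\tau)(X,S)=(FX,\,a\mapsto\{\tau_a\circ Fk\mid k\in S(a)\})$, and analogously for $N$-tuples and $(T,\sigma)$. *)

theory Defs
  imports "HOL-Algebra.Complete_Lattice"
begin

section \<open>Categories, functors and natural transformations\<close>

text \<open>
  The carriers \<open>Ob C\<close> and \<open>Mor C\<close> are subsets of the types \<open>'o\<close> and \<open>'m\<close>; the operations are total
  functions whose values outside the carriers (or on non-composable pairs) are irrelevant.
\<close>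

record ('o, 'm) cat =
  Ob :: "'o set"
  Mor :: "'m set"
  Dom :: "'m \<Rightarrow> 'o"
  Cod :: "'m \<Rightarrow> 'o"
  Id :: "'o \<Rightarrow> 'm"
  Comp :: "'m \<Rightarrow> 'm \<Rightarrow> 'm"  (infixr "\<cdot>\<index>" 75)

definition Hom :: "('o, 'm, 'z) cat_scheme \<Rightarrow> 'o \<Rightarrow> 'o \<Rightarrow> 'm set" where
  "Hom C X Y = {f \<in> Mor C. Dom C f = X \<and> Cod C f = Y}"

locale category =
  fixes C :: "('o, 'm) cat" (structure)
  assumes Dom_Ob: "f \<in> Mor C \<Longrightarrow> Dom C f \<in> Ob C"
    and Cod_Ob: "f \<in> Mor C \<Longrightarrow> Cod C f \<in> Ob C"
    and Id_Hom: "X \<in> Ob C \<Longrightarrow> Id C X \<in> Hom C X X"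
    and Comp_Hom: "f \<in> Hom C X Y \<Longrightarrow> g \<in> Hom C Y Z \<Longrightarrow> g \<cdot> f \<in> Hom C X Z"
    and Id_left: "f \<in> Hom C X Y \<Longrightarrow> Id C Y \<cdot> f = f"
    and Id_right: "f \<in> Hom C X Y \<Longrightarrow> f \<cdot> Id C X = f"
    and Comp_assoc: "f \<in> Hom C W X \<Longrightarrow> g \<in> Hom C X Y \<Longrightarrow> h \<in> Hom C Y Z
      \<Longrightarrow> (h \<cdot> g) \<cdot> f = h \<cdot> (g \<cdot> f)"

locale discrete_category = category +
  assumes Mor_Id: "f \<in> Mor C \<Longrightarrow> f = Id C (Dom C f)"

record ('o, 'm, 'x, 'y) fctr =
  fobj :: "'o \<Rightarrow> 'x"
  fmor :: "'m \<Rightarrow> 'y"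

locale is_functor = dom: category C + cod: category D
  for C :: "('o, 'm) cat" and D :: "('x, 'y) cat" +
  fixes F :: "('o, 'm, 'x, 'y) fctr"
  assumes fobj_Ob: "X \<in> Ob C \<Longrightarrow> fobj F X \<in> Ob D"
    and fmor_Hom: "f \<in> Hom C X Y \<Longrightarrow> fmor F f \<in> Hom D (fobj F X) (fobj F Y)"
    and fmor_Id: "X \<in> Ob C \<Longrightarrow> fmor F (Id C X) = Id D (fobj F X)"
    and fmor_Comp: "f \<in> Hom C X Y \<Longrightarrow> g \<in> Hom C Y Z
      \<Longrightarrow> fmor F (g \<cdot>\<^bsub>C\<^esub> f) = fmor F g \<cdot>\<^bsub>D\<^esub> fmor F f"

definition functor_comp ::
  "('x, 'y, 'u, 'v) fctr \<Rightarrow> ('o, 'm, 'x, 'y) fctr \<Rightarrow> ('o, 'm, 'u, 'v) fctr"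
  (infixr "\<odot>" 70) where
  "G \<odot> F = \<lparr>fobj = (\<lambda>X. fobj G (fobj F X)), fmor = (\<lambda>f. fmor G (fmor F f))\<rparr>"

text \<open>Equality of functors on \<open>C\<close>, disregarding the values outside the carriers of \<open>C\<close>.\<close>

definition functor_eq ::
  "('o, 'm) cat \<Rightarrow> ('o, 'm, 'x, 'y) fctr \<Rightarrow> ('o, 'm, 'x, 'y) fctr \<Rightarrow> bool" where
  "functor_eq C F G \<longleftrightarrow>
    (\<forall>X \<in> Ob C. fobj F X = fobj G X) \<and> (\<forall>f \<in> Mor C. fmor F f = fmor G f)"

locale natural_transformation = src: is_functor C D F + tgt: is_functor C D G
  for C :: "('o, 'm) cat" and D :: "('x, 'y) cat"
    and F :: "('o, 'm, 'x, 'y) fctr" and G :: "('o, 'm, 'x, 'y) fctr" +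
  fixes \<alpha> :: "'o \<Rightarrow> 'y"
  assumes component_Hom: "X \<in> Ob C \<Longrightarrow> \<alpha> X \<in> Hom D (fobj F X) (fobj G X)"
    and naturality: "f \<in> Hom C X Y \<Longrightarrow> \<alpha> Y \<cdot>\<^bsub>D\<^esub> fmor F f = fmor G f \<cdot>\<^bsub>D\<^esub> \<alpha> X"

text \<open>The \<open>N\<close>-fold power of a category: \<open>N\<close>-tuples are lists of length \<open>N\<close>.\<close>

definition power_cat :: "nat \<Rightarrow> ('o, 'm) cat \<Rightarrow> ('o list, 'm list) cat" where
  "power_cat N C =
    \<lparr>Ob = {Xs. length Xs = N \<and> set Xs \<subseteq> Ob C},
     Mor = {fs. length fs = N \<and> set fs \<subseteq> Mor C},
     Dom = map (Dom C),
     Cod = map (Cod C),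
     Id = map (Id C),
     Comp = map2 (Comp C)\<rparr>"

definition power_functor ::
  "('o, 'm, 'x, 'y) fctr \<Rightarrow> ('o list, 'm list, 'x list, 'y list) fctr" where
  "power_functor F = \<lparr>fobj = map (fobj F), fmor = map (fmor F)\<rparr>"

text \<open>The \<open>N\<close>-fold tupling \<open>\<langle>F, \<dots>, F\<rangle> : C \<rightarrow> D\<^sup>N\<close> of a functor \<open>F : C \<rightarrow> D\<close>.\<close>

definition tuple_functor ::
  "nat \<Rightarrow> ('o, 'm, 'x, 'y) fctr \<Rightarrow> ('o, 'm, 'x list, 'y list) fctr" where
  "tuple_functor N F =
    \<lparr>fobj = (\<lambda>X. replicate N (fobj F X)), fmor = (\<lambda>f. replicate N (fmor F f))\<rparr>"


section \<open>Posetal fibrations with complete fibers\<close>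

text \<open>The fiber over \<open>X\<close>, ordered by the existence of a vertical morphism.\<close>

definition fiber ::
  "('e, 'n) cat \<Rightarrow> ('o, 'm) cat \<Rightarrow> ('e, 'n, 'o, 'm) fctr \<Rightarrow> 'o \<Rightarrow> 'e gorder" where
  "fiber E B p X =
    \<lparr>carrier = {P \<in> Ob E. fobj p P = X},
     eq = (=),
     le = (\<lambda>P Q. \<exists>h \<in> Hom E P Q. fmor p h = Id B X)\<rparr>"

definition cartesian ::
  "('e, 'n) cat \<Rightarrow> ('o, 'm) cat \<Rightarrow> ('e, 'n, 'o, 'm) fctr \<Rightarrow> 'n \<Rightarrow> bool" where
  "cartesian E B p f \<longleftrightarrow> f \<in> Mor E \<and>
    (\<forall>R \<in> Ob E. \<forall>g \<in> Hom E R (Cod E f). \<forall>u \<in> Hom B (fobj p R) (fobj p (Dom E f)).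
      fmor p g = fmor p f \<cdot>\<^bsub>B\<^esub> u \<longrightarrow>
      (\<exists>!h. h \<in> Hom E R (Dom E f) \<and> fmor p h = u \<and> f \<cdot>\<^bsub>E\<^esub> h = g))"

locale fibration = is_functor E B p
  for E :: "('e, 'n) cat" and B :: "('o, 'm) cat" and p :: "('e, 'n, 'o, 'm) fctr" +
  assumes cartesian_lift: "Q \<in> Ob E \<Longrightarrow> f \<in> Hom B X (fobj p Q) \<Longrightarrow>
    \<exists>P \<in> Ob E. \<exists>g \<in> Hom E P Q. cartesian E B p g \<and> fmor p g = f"

locale posetal_fibration = fibration +
  assumes fiber_thin: "h \<in> Hom E P Q \<Longrightarrow> h' \<in> Hom E P Q \<Longrightarrow>
      fmor p h = Id B (fobj p P) \<Longrightarrow> fmor p h' = Id B (fobj p P) \<Longrightarrow> h = h'"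
    and fiber_partial_order: "X \<in> Ob B \<Longrightarrow> partial_order (fiber E B p X)"

text \<open>
  \<open>reindex E B p f Q\<close> is \<open>f\<^sup>*Q\<close>, the domain of the cartesian lift of \<open>f : X \<rightarrow> pQ\<close> to \<open>Q\<close>.  In a
  posetal fibration this domain is unique, because isomorphic objects of a fiber are equal.
\<close>

definition reindex ::
  "('e, 'n) cat \<Rightarrow> ('o, 'm) cat \<Rightarrow> ('e, 'n, 'o, 'm) fctr \<Rightarrow> 'm \<Rightarrow> 'e \<Rightarrow> 'e" where
  "reindex E B p f Q =
    (THE P. P \<in> Ob E \<and> (\<exists>g \<in> Hom E P Q. cartesian E B p g \<and> fmor p g = f))"

locale clat_fibration = posetal_fibration +
  assumes fiber_complete_lattice: "X \<in> Ob B \<Longrightarrow> complete_lattice (fiber E B p X)"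
    and reindex_meet: "f \<in> Hom B X Y \<Longrightarrow> S \<subseteq> carrier (fiber E B p Y) \<Longrightarrow>
      reindex E B p f (\<Sqinter>\<^bsub>fiber E B p Y\<^esub> S) = \<Sqinter>\<^bsub>fiber E B p X\<^esub> (reindex E B p f ` S)"

locale clat_fibration_truth_values =
  clat_fibration E B p + index: discrete_category A +
  base: is_functor A B \<O> + truth: is_functor A E \<Omega>
  for E :: "('e, 'n) cat" and B :: "('o, 'm) cat" and p :: "('e, 'n, 'o, 'm) fctr"
    and A :: "('a, 'k) cat" and \<O> :: "('a, 'k, 'o, 'm) fctr" and \<Omega> :: "('a, 'k, 'e, 'n) fctr" +
  assumes over: "functor_eq A \<O> (p \<odot> \<Omega>)"


section \<open>Codensity liftings and one-step composition\<close>

text \<open>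
  Both liftings are given by their action on objects, which determines them because \<open>p\<close> is
  faithful.  The meets are taken in the fiber over \<open>F(pP)\<close>, respectively
  \<open>T(pP\<^sub>1, \<dots>, pP\<^sub>N)\<close>; an empty meet is the top element of that fiber.
\<close>

definition codensity_lifting ::
  "('e, 'n) cat \<Rightarrow> ('o, 'm) cat \<Rightarrow> ('e, 'n, 'o, 'm) fctr \<Rightarrow> ('a, 'k) cat \<Rightarrow> ('a, 'k, 'e, 'n) fctr
    \<Rightarrow> ('o, 'm, 'o, 'm) fctr \<Rightarrow> ('a \<Rightarrow> 'm) \<Rightarrow> 'e \<Rightarrow> 'e" where
  "codensity_lifting E B p A \<Omega> F \<tau> P =
    \<Sqinter>\<^bsub>fiber E B p (fobj F (fobj p P))\<^esub>
      {reindex E B p (\<tau> a \<cdot>\<^bsub>B\<^esub> fmor F (fmor p k)) (fobj \<Omega> a) | a k.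
        a \<in> Ob A \<and> k \<in> Hom E P (fobj \<Omega> a)}"

definition n_codensity_lifting ::
  "('e, 'n) cat \<Rightarrow> ('o, 'm) cat \<Rightarrow> ('e, 'n, 'o, 'm) fctr \<Rightarrow> ('a, 'k) cat \<Rightarrow> ('a, 'k, 'e, 'n) fctr
    \<Rightarrow> nat \<Rightarrow> ('o list, 'm list, 'o, 'm) fctr \<Rightarrow> ('a \<Rightarrow> 'm) \<Rightarrow> 'e list \<Rightarrow> 'e" where
  "n_codensity_lifting E B p A \<Omega> N T \<sigma> Ps =
    \<Sqinter>\<^bsub>fiber E B p (fobj T (fobj (power_functor p) Ps))\<^esub>
      {reindex E B p (\<sigma> a \<cdot>\<^bsub>B\<^esub> fmor T (fmor (power_functor p) ks)) (fobj \<Omega> a) | a ks.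
        a \<in> Ob A \<and> ks \<in> Hom (power_cat N E) Ps (fobj (tuple_functor N \<Omega>) a)}"

locale one_step_composition =
  endo: is_functor B B F + oper: is_functor "power_cat N B" B T +
  law: natural_transformation "power_cat N B" B "T \<odot> power_functor F" "F \<odot> T" lam
  for B :: "('o, 'm) cat" and F :: "('o, 'm, 'o, 'm) fctr"
    and N :: nat and T :: "('o list, 'm list, 'o, 'm) fctr" and lam :: "'o list \<Rightarrow> 'm"

definition lifts_along ::
  "('e, 'n) cat \<Rightarrow> ('o, 'm) cat \<Rightarrow> ('e, 'n, 'o, 'm) fctr \<Rightarrow> ('a, 'k) cat \<Rightarrow> ('a, 'k, 'e, 'n) fctr
    \<Rightarrow> ('o, 'm, 'o, 'm) fctr \<Rightarrow> ('a \<Rightarrow> 'm)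
    \<Rightarrow> nat \<Rightarrow> ('o list, 'm list, 'o, 'm) fctr \<Rightarrow> ('o list \<Rightarrow> 'm) \<Rightarrow> ('a \<Rightarrow> 'm) \<Rightarrow> bool" where
  "lifts_along E B p A \<Omega> F \<tau> N T lam \<sigma> \<longleftrightarrow>
    (\<forall>Ps \<in> Ob (power_cat N E).
      n_codensity_lifting E B p A \<Omega> N T \<sigma> (map (codensity_lifting E B p A \<Omega> F \<tau>) Ps)
        \<sqsubseteq>\<^bsub>fiber E B p (fobj T (map (\<lambda>P. fobj F (fobj p P)) Ps))\<^esub>
      reindex E B p (lam (map (fobj p) Ps))
        (codensity_lifting E B p A \<Omega> F \<tau> (n_codensity_lifting E B p A \<Omega> N T \<sigma> Ps)))"

end

theory Submission
  imports Defs
begin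

text \<open>
  Reindexing preserves meets and composition, so by (2) the right-hand side is the meet of the
  objects \<open>(\<tau>\<^sub>a \<circ> F(\<sigma>\<^sub>a \<circ> T(pk\<^sub>1, \<dots>, pk\<^sub>N)) \<circ> \<lambda>)\<^sup>*\<Omega>(a)\<close>.  By naturality of \<open>\<lambda>\<close> and (1) the
  morphism reindexed along is \<open>\<sigma>\<^sub>a \<circ> T(\<tau>\<^sub>a \<circ> F(pk\<^sub>1), \<dots>, \<tau>\<^sub>a \<circ> F(pk\<^sub>N))\<close>.  Each \<open>\<tau>\<^sub>a \<circ> F(pk\<^sub>i)\<close>
  underlies a morphism from the codensity lifting of \<open>P\<^sub>i\<close> to \<open>\<Omega>(a)\<close>, so the left-hand side is a
  meet over a larger family.
\<close>

section \<open>Morphisms of a power category\<close>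

lemma Hom_power_cat_iff:
  "fs \<in> Hom (power_cat N C) Xs Ys \<longleftrightarrow>
    length fs = N \<and> set fs \<subseteq> Mor C \<and> map (Dom C) fs = Xs \<and> map (Cod C) fs = Ys"
  by (auto simp: Hom_def power_cat_def)

text \<open>Source and target are written as images of the same list \<open>xs\<close>, so that a
  tuple can be typed entry by entry, without positions.\<close>

lemma Hom_power_catI:
  assumes "\<And>x. x \<in> set xs \<Longrightarrow> f x \<in> Hom C (d x) (c x)" and "length xs = N"
  shows "map f xs \<in> Hom (power_cat N C) (map d xs) (map c xs)"
  using assms unfolding Hom_power_cat_iff by (auto simp: Hom_def)

text \<open>A tuple has the list of domains of its entries as its source. Replacing
  \<open>Ps\<close> by \<open>map (Dom C) ks\<close> lets data attached to the entries, such as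
  lifts, be given as functions of \<open>k\<close> instead of a position.\<close>

lemma Hom_power_cat_replicateD:
  assumes "ks \<in> Hom (power_cat N C) Ps (replicate N Q)"
  shows "length ks = N" and "Ps = map (Dom C) ks"
    and "k \<in> set ks \<Longrightarrow> k \<in> Hom C (Dom C k) Q"
proof -
  show len: "length ks = N" and "Ps = map (Dom C) ks"
    using assms by (auto simp: Hom_power_cat_iff)
  show "k \<in> Hom C (Dom C k) Q" if k: "k \<in> set ks"
  proof -
    have cods: "map (Cod C) ks = replicate N Q" and "set ks \<subseteq> Mor C"
      using assms by (simp_all add: Hom_power_cat_iff)
    have "Cod C k \<in> set (replicate N Q)" using k unfolding cods[symmetric] by simp
    then show ?thesis using k \<open>set ks \<subseteq> Mor C\<close> by (auto simp: Hom_def)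
  qed
qed

lemma (in category) Hom_Ob:
  "f \<in> Hom C X Y \<Longrightarrow> X \<in> Ob C" "f \<in> Hom C X Y \<Longrightarrow> Y \<in> Ob C"
  using Dom_Ob Cod_Ob by (auto simp: Hom_def)

lemma mem_fiber_iff: "P \<in> carrier (fiber E B p X) \<longleftrightarrow> P \<in> Ob E \<and> fobj p P = X"
  by (simp add: fiber_def)

section \<open>Cartesian morphisms and their composites\<close>

lemma cartesian_factor:
  assumes "cartesian E B p f" and "f \<in> Hom E P Q" and "R \<in> Ob E" and "g \<in> Hom E R Q"
    and "u \<in> Hom B (fobj p R) (fobj p P)" and "fmor p g = fmor p f \<cdot>\<^bsub>B\<^esub> u"
  shows "\<exists>!h. h \<in> Hom E R P \<and> fmor p h = u \<and> f \<cdot>\<^bsub>E\<^esub> h = g"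
proof -
  have "Dom E f = P" "Cod E f = Q" using assms(2) by (simp_all add: Hom_def)
  then show ?thesis
    using assms(1)[unfolded cartesian_def, THEN conjunct2, rule_format, of R g u] assms(3-6) by simp
qed

text \<open>The factorization is made in two stages: \<open>k\<close> factors through
  \<open>g\<close> as some \<open>l\<close> over the composite of \<open>u\<close> and
  \<open>fmor F f\<close>, and \<open>l\<close> then factors through \<open>f\<close> over
  \<open>u\<close>.\<close>

lemma (in is_functor) cartesian_comp:
  assumes f: "cartesian C D F f" "f \<in> Hom C P Q" and g: "cartesian C D F g" "g \<in> Hom C Q S"
  shows "cartesian C D F (g \<cdot>\<^bsub>C\<^esub> f)"
  unfolding cartesian_def
proof (intro conjI ballI impI)
  have gf: "g \<cdot>\<^bsub>C\<^esub> f \<in> Hom C P S" using dom.Comp_Hom f g by blast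
  then show "g \<cdot>\<^bsub>C\<^esub> f \<in> Mor C" by (simp add: Hom_def)
  have ends: "Dom C (g \<cdot>\<^bsub>C\<^esub> f) = P" "Cod C (g \<cdot>\<^bsub>C\<^esub> f) = S" using gf by (auto simp: Hom_def)
  fix R k u
  assume R: "R \<in> Ob C" and "k \<in> Hom C R (Cod C (g \<cdot>\<^bsub>C\<^esub> f))"
    and "u \<in> Hom D (fobj F R) (fobj F (Dom C (g \<cdot>\<^bsub>C\<^esub> f)))"
    and eq: "fmor F k = fmor F (g \<cdot>\<^bsub>C\<^esub> f) \<cdot>\<^bsub>D\<^esub> u"
  then have k: "k \<in> Hom C R S" and u: "u \<in> Hom D (fobj F R) (fobj F P)"
    by (simp_all add: ends)
  have fu: "fmor F f \<cdot>\<^bsub>D\<^esub> u \<in> Hom D (fobj F R) (fobj F Q)"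
    using u fmor_Hom[OF f(2)] cod.Comp_Hom by blast
  have "fmor F k = fmor F g \<cdot>\<^bsub>D\<^esub> (fmor F f \<cdot>\<^bsub>D\<^esub> u)"
    using eq fmor_Comp[OF f(2) g(2)] cod.Comp_assoc[OF u fmor_Hom[OF f(2)] fmor_Hom[OF g(2)]]
    by simp
  note ex1_l = cartesian_factor[OF g R k fu this]
  then obtain l where l: "l \<in> Hom C R Q" "fmor F l = fmor F f \<cdot>\<^bsub>D\<^esub> u" "g \<cdot>\<^bsub>C\<^esub> l = k"
    by blast
  note ex1_h = cartesian_factor[OF f R l(1) u l(2)]
  have assoc: "(g \<cdot>\<^bsub>C\<^esub> f) \<cdot>\<^bsub>C\<^esub> h = g \<cdot>\<^bsub>C\<^esub> (f \<cdot>\<^bsub>C\<^esub> h)" if "h \<in> Hom C R P" for h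
    using dom.Comp_assoc that f(2) g(2) by blast
  \<comment> \<open>For a competing factor \<open>h\<close>, the composite of \<open>h\<close> and
    \<open>f\<close> factors \<open>k\<close> through \<open>g\<close> over the same base morphism
    as \<open>l\<close>. Uniqueness for \<open>g\<close> gives equality with \<open>l\<close>, and
    uniqueness for \<open>f\<close> then determines \<open>h\<close>.\<close>
  have "f \<cdot>\<^bsub>C\<^esub> h = l" if h: "h \<in> Hom C R P" "fmor F h = u" "(g \<cdot>\<^bsub>C\<^esub> f) \<cdot>\<^bsub>C\<^esub> h = k" for h
  proof -
    have "f \<cdot>\<^bsub>C\<^esub> h \<in> Hom C R Q" using dom.Comp_Hom h(1) f(2) by blast
    moreover have "fmor F (f \<cdot>\<^bsub>C\<^esub> h) = fmor F f \<cdot>\<^bsub>D\<^esub> u"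
      using fmor_Comp[OF h(1) f(2)] h(2) by simp
    ultimately show ?thesis using ex1_l l h(3) assoc[OF h(1)] by metis
  qed
  then have "\<exists>!h. h \<in> Hom C R P \<and> fmor F h = u \<and> (g \<cdot>\<^bsub>C\<^esub> f) \<cdot>\<^bsub>C\<^esub> h = k"
    using ex1_h assoc l(3) by metis
  then show "\<exists>!h. h \<in> Hom C R (Dom C (g \<cdot>\<^bsub>C\<^esub> f)) \<and> fmor F h = u \<and> (g \<cdot>\<^bsub>C\<^esub> f) \<cdot>\<^bsub>C\<^esub> h = k"
    by (simp add: ends)
qed

section \<open>Reindexing in a posetal fibration\<close>

context posetal_fibration
begin

text \<open>The vertical morphism witnessing the order is the factor of \<open>g\<close> through the
  cartesian \<open>g'\<close> over the identity.\<close>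

lemma cartesian_lift_le:
  assumes g: "g \<in> Hom E P Q" and g': "g' \<in> Hom E P' Q" "cartesian E B p g'"
    and eq: "fmor p g = fmor p g'"
  shows "P \<sqsubseteq>\<^bsub>fiber E B p (fobj p P)\<^esub> P'"
proof -
  have same: "fobj p P' = fobj p P"
    using fmor_Hom[OF g] fmor_Hom[OF g'(1)] eq by (simp add: Hom_def)
  have P: "P \<in> Ob E" using dom.Hom_Ob(1)[OF g] .
  have "Id B (fobj p P) \<in> Hom B (fobj p P) (fobj p P')"
    using cod.Id_Hom fobj_Ob P same by simp
  moreover have "fmor p g = fmor p g' \<cdot>\<^bsub>B\<^esub> Id B (fobj p P)"
    using cod.Id_right[OF fmor_Hom[OF g]] eq by simp
  ultimately have "\<exists>h \<in> Hom E P P'. fmor p h = Id B (fobj p P)"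
    using cartesian_factor[OF g'(2,1) P g] by blast
  then show ?thesis by (simp add: fiber_def)
qed

text \<open>Two cartesian lifts of one base morphism to the same object factor through each other
  vertically, so antisymmetry in the fiber identifies their domains. Hence the definite description
  in \<open>reindex\<close> denotes the domain of any such lift.\<close>

lemma reindex_eqI:
  assumes g: "g \<in> Hom E P Q" "cartesian E B p g"
  shows "reindex E B p (fmor p g) Q = P"
  unfolding reindex_def
proof (rule the_equality)
  show "P \<in> Ob E \<and> (\<exists>h \<in> Hom E P Q. cartesian E B p h \<and> fmor p h = fmor p g)"
    using g dom.Hom_Ob by blast
next
  fix P' assume "P' \<in> Ob E \<and> (\<exists>h \<in> Hom E P' Q. cartesian E B p h \<and> fmor p h = fmor p g)"
  then obtain g' where g': "g' \<in> Hom E P' Q" "cartesian E B p g'" "fmor p g' = fmor p g"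
    by blast
  have same: "fobj p P' = fobj p P"
    using fmor_Hom[OF g(1)] fmor_Hom[OF g'(1)] g'(3) by (simp add: Hom_def)
  have P: "P \<in> Ob E" "P' \<in> Ob E" using dom.Hom_Ob(1) g(1) g'(1) by blast+
  interpret fib: partial_order "fiber E B p (fobj p P)"
    using fiber_partial_order fobj_Ob P(1) .
  have "P \<sqsubseteq>\<^bsub>fiber E B p (fobj p P)\<^esub> P'" "P' \<sqsubseteq>\<^bsub>fiber E B p (fobj p P)\<^esub> P"
    using cartesian_lift_le[OF g(1) g'(1,2)] cartesian_lift_le[OF g'(1) g] g'(3) same by simp_all
  then show "P' = P"
    using fib.le_antisym P same fib.eq_is_equal by (simp add: mem_fiber_iff)
qed

lemma reindex_lift:
  assumes "Q \<in> Ob E" and "f \<in> Hom B X (fobj p Q)"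
  obtains g where "g \<in> Hom E (reindex E B p f Q) Q" "cartesian E B p g" "fmor p g = f"
proof -
  obtain P g where "g \<in> Hom E P Q" "cartesian E B p g" "fmor p g = f"
    using cartesian_lift[OF assms] by blast
  then show thesis using that reindex_eqI by metis
qed

lemma reindex_carrier:
  assumes "Q \<in> Ob E" and "f \<in> Hom B X (fobj p Q)"
  shows "reindex E B p f Q \<in> carrier (fiber E B p X)"
proof -
  obtain g where g: "g \<in> Hom E (reindex E B p f Q) Q" "fmor p g = f"
    using reindex_lift[OF assms] .
  have "fobj p (reindex E B p f Q) = X"
    using fmor_Hom[OF g(1)] g(2) assms(2) by (simp add: Hom_def)
  then show ?thesis using dom.Hom_Ob(1)[OF g(1)] by (simp add: mem_fiber_iff)
qed

text \<open>The composite of the two cartesian lifts is a cartesian lift of the composite base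
  morphism, and the domain of such a lift is unique.\<close>

lemma reindex_comp:
  assumes Q: "Q \<in> Ob E" and f: "f \<in> Hom B X Y" and g: "g \<in> Hom B Y (fobj p Q)"
  shows "reindex E B p f (reindex E B p g Q) = reindex E B p (g \<cdot>\<^bsub>B\<^esub> f) Q"
proof -
  obtain g' where g': "g' \<in> Hom E (reindex E B p g Q) Q" "cartesian E B p g'" "fmor p g' = g"
    using reindex_lift[OF Q g] .
  have R: "reindex E B p g Q \<in> Ob E" "fobj p (reindex E B p g Q) = Y"
    using reindex_carrier[OF Q g] by (auto simp: mem_fiber_iff)
  have "f \<in> Hom B X (fobj p (reindex E B p g Q))" using f R(2) by simp
  then obtain f' where f': "f' \<in> Hom E (reindex E B p f (reindex E B p g Q)) (reindex E B p g Q)"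
      "cartesian E B p f'" "fmor p f' = f"
    using reindex_lift[OF R(1)] by blast
  have "fmor p (g' \<cdot>\<^bsub>E\<^esub> f') = g \<cdot>\<^bsub>B\<^esub> f" using fmor_Comp[OF f'(1) g'(1)] f'(3) g'(3) by simp
  then show ?thesis
    using reindex_eqI[OF dom.Comp_Hom[OF f'(1) g'(1)] cartesian_comp[OF f'(2,1) g'(2,1)]] by simp
qed

text \<open>A vertical morphism into the reindexed object, followed by the cartesian lift, lies over
  \<open>f\<close>. This passes from an inequality in a fiber to a morphism that can serve as an
  index of a codensity meet.\<close>

lemma lift_of_le_reindex:
  assumes Q: "Q \<in> Ob E" and f: "f \<in> Hom B X (fobj p Q)"
    and le: "P \<sqsubseteq>\<^bsub>fiber E B p X\<^esub> reindex E B p f Q"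
  shows "\<exists>l \<in> Hom E P Q. fmor p l = f"
proof -
  obtain g where g: "g \<in> Hom E (reindex E B p f Q) Q" "fmor p g = f"
    using reindex_lift[OF Q f] .
  obtain h where h: "h \<in> Hom E P (reindex E B p f Q)" "fmor p h = Id B X"
    using le by (auto simp: fiber_def)
  have "fmor p (g \<cdot>\<^bsub>E\<^esub> h) = f"
    using fmor_Comp[OF h(1) g(1)] h(2) g(2) cod.Id_right[OF f] by simp
  then show ?thesis using dom.Comp_Hom[OF h(1) g(1)] by blast
qed

end

section \<open>Meets in the fibers\<close>

context clat_fibration
begin

lemma fiber_weak_complete_lattice:
  assumes "X \<in> Ob B"
  shows "weak_complete_lattice (fiber E B p X)"
proof -
  interpret complete_lattice "fiber E B p X" using fiber_complete_lattice[OF assms] .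
  show ?thesis by unfold_locales
qed

lemma Inf_fiber_carrier:
  assumes "X \<in> Ob B" and "S \<subseteq> carrier (fiber E B p X)"
  shows "\<Sqinter>\<^bsub>fiber E B p X\<^esub> S \<in> carrier (fiber E B p X)"
  using weak_complete_lattice.inf_closed[OF fiber_weak_complete_lattice[OF assms(1)] assms(2)] .

lemma Inf_fiber_lower:
  assumes "X \<in> Ob B" and "S \<subseteq> carrier (fiber E B p X)" and "P \<in> S"
  shows "\<Sqinter>\<^bsub>fiber E B p X\<^esub> S \<sqsubseteq>\<^bsub>fiber E B p X\<^esub> P"
  using weak_complete_lattice.inf_lower[OF fiber_weak_complete_lattice[OF assms(1)] assms(2,3)] .

text \<open>The meet of \<open>S\<close> is a lower bound of \<open>S'\<close>, hence lies below the
  greatest one.\<close>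

lemma Inf_fiber_mono:
  assumes X: "X \<in> Ob B" and S: "S \<subseteq> carrier (fiber E B p X)" and sub: "S' \<subseteq> S"
  shows "\<Sqinter>\<^bsub>fiber E B p X\<^esub> S \<sqsubseteq>\<^bsub>fiber E B p X\<^esub> \<Sqinter>\<^bsub>fiber E B p X\<^esub> S'"
proof (rule weak_complete_lattice.inf_greatest[OF fiber_weak_complete_lattice[OF X]])
  show "S' \<subseteq> carrier (fiber E B p X)" using S sub by simp
  show "\<Sqinter>\<^bsub>fiber E B p X\<^esub> S \<in> carrier (fiber E B p X)" using Inf_fiber_carrier[OF X S] .
  show "\<Sqinter>\<^bsub>fiber E B p X\<^esub> S \<sqsubseteq>\<^bsub>fiber E B p X\<^esub> P" if "P \<in> S'" for P
    using Inf_fiber_lower[OF X S] sub that by blast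
qed

end

lemma (in clat_fibration_truth_values) \<O>_eq:
  "a \<in> Ob A \<Longrightarrow> fobj \<O> a = fobj p (fobj \<Omega> a)"
  using over by (simp add: functor_eq_def functor_comp_def)

theorem theorem4:
  fixes E :: "('e, 'n) cat" and B :: "('o, 'm) cat" and p :: "('e, 'n, 'o, 'm) fctr"
    and A :: "('a, 'k) cat" and \<O> :: "('a, 'k, 'o, 'm) fctr" and \<Omega> :: "('a, 'k, 'e, 'n) fctr"
    and F :: "('o, 'm, 'o, 'm) fctr" and \<tau> :: "'a \<Rightarrow> 'm"
    and N :: nat and T :: "('o list, 'm list, 'o, 'm) fctr" and lam :: "'o list \<Rightarrow> 'm"
    and \<sigma> :: "'a \<Rightarrow> 'm"
  assumes fib: "clat_fibration_truth_values E B p A \<O> \<Omega>"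
    and F: "is_functor B B F"
    and \<tau>: "natural_transformation A B (F \<odot> \<O>) \<O> \<tau>"
    and comp: "one_step_composition B F N T lam"
    and \<sigma>: "natural_transformation A B (T \<odot> tuple_functor N \<O>) \<O> \<sigma>"
    and cond1: "\<And>a. a \<in> Ob A \<Longrightarrow>
      \<sigma> a \<cdot>\<^bsub>B\<^esub> fmor T (replicate N (\<tau> a)) =
      \<tau> a \<cdot>\<^bsub>B\<^esub> fmor F (\<sigma> a) \<cdot>\<^bsub>B\<^esub> lam (replicate N (fobj \<O> a))"
    and cond2: "\<And>Ps. Ps \<in> Ob (power_cat N E) \<Longrightarrow>
      \<Sqinter>\<^bsub>fiber E B p (fobj F (fobj T (fobj (power_functor p) Ps)))\<^esub>
        {reindex E B p
            (\<tau> a \<cdot>\<^bsub>B\<^esub> fmor F (\<sigma> a \<cdot>\<^bsub>B\<^esub> fmor T (fmor (power_functor p) ks))) (fobj \<Omega> a) | a ks.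
          a \<in> Ob A \<and> ks \<in> Hom (power_cat N E) Ps (fobj (tuple_functor N \<Omega>) a)} =
      codensity_lifting E B p A \<Omega> F \<tau> (n_codensity_lifting E B p A \<Omega> N T \<sigma> Ps)"
  shows "lifts_along E B p A \<Omega> F \<tau> N T lam \<sigma>"
proof -
  interpret clat_fibration_truth_values E B p A \<O> \<Omega> by (rule fib)
  interpret F: is_functor B B F by (rule F)
  interpret \<tau>: natural_transformation A B "F \<odot> \<O>" \<O> \<tau> by (rule \<tau>)
  interpret \<sigma>: natural_transformation A B "T \<odot> tuple_functor N \<O>" \<O> \<sigma> by (rule \<sigma>)
  interpret comp: one_step_composition B F N T lam by (rule comp)

  \<comment> \<open>Sources and targets of the morphisms involved\<close>
  have \<Omega>_Ob: "fobj \<Omega> a \<in> Ob E" if "a \<in> Ob A" for a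
    using truth.fobj_Ob that .
  have \<tau>_Hom: "\<tau> a \<in> Hom B (fobj F (fobj p (fobj \<Omega> a))) (fobj p (fobj \<Omega> a))" if "a \<in> Ob A" for a
    using \<tau>.component_Hom[OF that] \<O>_eq[OF that] by (simp add: functor_comp_def)
  have \<sigma>_Hom: "\<sigma> a \<in> Hom B (fobj T (replicate N (fobj p (fobj \<Omega> a)))) (fobj p (fobj \<Omega> a))"
    if "a \<in> Ob A" for a
    using \<sigma>.component_Hom[OF that] \<O>_eq[OF that]
    by (simp add: functor_comp_def tuple_functor_def)
  have lam_Hom: "lam Xs \<in> Hom B (fobj T (map (fobj F) Xs)) (fobj F (fobj T Xs))"
    if "Xs \<in> Ob (power_cat N B)" for Xs
    using comp.law.component_Hom[OF that] by (simp add: functor_comp_def power_functor_def)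
  have \<tau>F_Hom: "\<tau> a \<cdot>\<^bsub>B\<^esub> fmor F (fmor p k) \<in> Hom B (fobj F (fobj p P)) (fobj p (fobj \<Omega> a))"
    if "a \<in> Ob A" "k \<in> Hom E P (fobj \<Omega> a)" for a k P
    using cod.Comp_Hom[OF F.fmor_Hom[OF fmor_Hom[OF that(2)]] \<tau>_Hom[OF that(1)]] .
  have pks_Hom: "map (fmor p) ks \<in>
      Hom (power_cat N B) (map (fobj p) Ps) (replicate N (fobj p (fobj \<Omega> a)))"
    if "ks \<in> Hom (power_cat N E) Ps (replicate N (fobj \<Omega> a))" for a ks Ps
  proof -
    note ks = Hom_power_cat_replicateD[OF that]
    show ?thesis
      using Hom_power_catI[of ks "fmor p" B "\<lambda>k. fobj p (Dom E k)" "\<lambda>_. fobj p (fobj \<Omega> a)" N]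
        ks fmor_Hom by (simp add: map_replicate_const comp_def)
  qed
  have \<sigma>T_Hom: "\<sigma> a \<cdot>\<^bsub>B\<^esub> fmor T (map (fmor p) ks) \<in>
      Hom B (fobj T (map (fobj p) Ps)) (fobj p (fobj \<Omega> a))"
    if "a \<in> Ob A" "ks \<in> Hom (power_cat N E) Ps (replicate N (fobj \<Omega> a))" for a ks Ps
    using cod.Comp_Hom[OF comp.oper.fmor_Hom[OF pks_Hom[OF that(2)]] \<sigma>_Hom[OF that(1)]] .

  \<comment> \<open>Morphisms out of the codensity lifting\<close>
  let ?F = "codensity_lifting E B p A \<Omega> F \<tau>"
  let ?T = "n_codensity_lifting E B p A \<Omega> N T \<sigma>"
  have F_family: "{reindex E B p (\<tau> a \<cdot>\<^bsub>B\<^esub> fmor F (fmor p k)) (fobj \<Omega> a) | a k.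
      a \<in> Ob A \<and> k \<in> Hom E P (fobj \<Omega> a)} \<subseteq> carrier (fiber E B p (fobj F (fobj p P)))" for P
    using reindex_carrier \<Omega>_Ob \<tau>F_Hom by blast
  have F_carrier: "?F P \<in> carrier (fiber E B p (fobj F (fobj p P)))" if "P \<in> Ob E" for P
    unfolding codensity_lifting_def
    using Inf_fiber_carrier[OF _ F_family] F.fobj_Ob fobj_Ob that by blast
  \<comment> \<open>The pair of \<open>a\<close> and \<open>k\<close> indexes a member of the family
    whose meet is \<open>?F P\<close>, so \<open>?F P\<close> lies below that member, and this
    inequality is realized by a morphism.\<close>
  have F_lift: "\<exists>l \<in> Hom E (?F P) (fobj \<Omega> a). fmor p l = \<tau> a \<cdot>\<^bsub>B\<^esub> fmor F (fmor p k)"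
    if a: "a \<in> Ob A" and k: "k \<in> Hom E P (fobj \<Omega> a)" for a k P
  proof (rule lift_of_le_reindex[OF \<Omega>_Ob[OF a] \<tau>F_Hom[OF a k]])
    show "?F P \<sqsubseteq>\<^bsub>fiber E B p (fobj F (fobj p P))\<^esub>
        reindex E B p (\<tau> a \<cdot>\<^bsub>B\<^esub> fmor F (fmor p k)) (fobj \<Omega> a)"
      unfolding codensity_lifting_def
      using Inf_fiber_lower[OF _ F_family] F.fobj_Ob fobj_Ob dom.Hom_Ob(1)[OF k] a k by blast
  qed

  \<comment> \<open>Comparison of the two meets\<close>
  show ?thesis
    unfolding lifts_along_def
  proof
    fix Ps assume Ps: "Ps \<in> Ob (power_cat N E)"
    define Xs where "Xs = map (fobj p) Ps"
    define Z where "Z = fobj T (map (fobj F) Xs)"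
    have Xs: "Xs \<in> Ob (power_cat N B)" and FXs: "map (fobj F) Xs \<in> Ob (power_cat N B)"
      using Ps fobj_Ob F.fobj_Ob by (auto simp: Xs_def power_cat_def)
    have Z: "Z \<in> Ob B" using comp.oper.fobj_Ob FXs by (simp add: Z_def)
    have lam: "lam Xs \<in> Hom B Z (fobj F (fobj T Xs))" using lam_Hom[OF Xs] by (simp add: Z_def)
    \<comment> \<open>The lifting of an object lies over its image under \<open>F\<close>. The
      left-hand meet is therefore taken in the fiber over \<open>Z\<close>, the source of
      \<open>lam Xs\<close>.\<close>
    have pF: "map (fobj p) (map ?F Ps) = map (fobj F) Xs"
      using F_carrier Ps by (auto simp: Xs_def power_cat_def mem_fiber_iff)
    \<comment> \<open>Indexing by pairs makes both families images, so that members can be compared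
      through their indices. \<open>I\<close> belongs to the right-hand family supplied by (2),
      \<open>J\<close> to the left-hand one.\<close>
    define I where "I = {(a, ks). a \<in> Ob A \<and> ks \<in> Hom (power_cat N E) Ps (replicate N (fobj \<Omega> a))}"
    define J where "J = {(a, ls). a \<in> Ob A \<and>
      ls \<in> Hom (power_cat N E) (map ?F Ps) (replicate N (fobj \<Omega> a))}"
    define f where "f = (\<lambda>(a, ks). \<tau> a \<cdot>\<^bsub>B\<^esub> fmor F (\<sigma> a \<cdot>\<^bsub>B\<^esub> fmor T (map (fmor p) ks)))"
    define g where "g = (\<lambda>(a, ls). \<sigma> a \<cdot>\<^bsub>B\<^esub> fmor T (map (fmor p) ls))"
    define SJ where "SJ = (\<lambda>j. reindex E B p (g j) (fobj \<Omega> (fst j))) ` J"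
    define SI where "SI = (\<lambda>i. reindex E B p (f i) (fobj \<Omega> (fst i))) ` I"
    have T_eq: "?T (map ?F Ps) = \<Sqinter>\<^bsub>fiber E B p Z\<^esub> SJ"
    proof -
      have "SJ = {reindex E B p (\<sigma> a \<cdot>\<^bsub>B\<^esub> fmor T (fmor (power_functor p) ls)) (fobj \<Omega> a) | a ls.
          a \<in> Ob A \<and> ls \<in> Hom (power_cat N E) (map ?F Ps) (fobj (tuple_functor N \<Omega>) a)}"
        by (auto simp: SJ_def J_def g_def power_functor_def tuple_functor_def image_iff; blast)
      then show ?thesis
        using pF by (simp add: n_codensity_lifting_def Z_def power_functor_def)
    qed
    have FT_eq: "?F (?T Ps) = \<Sqinter>\<^bsub>fiber E B p (fobj F (fobj T Xs))\<^esub> SI"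
    proof -
      have "SI = {reindex E B p (\<tau> a \<cdot>\<^bsub>B\<^esub> fmor F (\<sigma> a \<cdot>\<^bsub>B\<^esub> fmor T (fmor (power_functor p) ks)))
          (fobj \<Omega> a) | a ks.
          a \<in> Ob A \<and> ks \<in> Hom (power_cat N E) Ps (fobj (tuple_functor N \<Omega>) a)}"
        by (auto simp: SI_def I_def f_def power_functor_def tuple_functor_def image_iff; blast)
      then show ?thesis using cond2[OF Ps] by (simp add: Xs_def power_functor_def)
    qed
    have f_Hom: "f (a, ks) \<in> Hom B (fobj F (fobj T Xs)) (fobj p (fobj \<Omega> a))"
      if "(a, ks) \<in> I" for a ks
      using that cod.Comp_Hom[OF F.fmor_Hom[OF \<sigma>T_Hom] \<tau>_Hom] by (auto simp: I_def f_def Xs_def)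
    have g_Hom: "g (a, ls) \<in> Hom B Z (fobj p (fobj \<Omega> a))" if "(a, ls) \<in> J" for a ls
      using that \<sigma>T_Hom[of a ls "map ?F Ps"] unfolding pF by (simp add: J_def g_def Z_def)
    have SI_carrier: "SI \<subseteq> carrier (fiber E B p (fobj F (fobj T Xs)))"
      using reindex_carrier[OF \<Omega>_Ob f_Hom] by (auto simp: SI_def I_def)
    have SJ_carrier: "SJ \<subseteq> carrier (fiber E B p Z)"
      using reindex_carrier[OF \<Omega>_Ob g_Hom] by (auto simp: SJ_def J_def)
    \<comment> \<open>The member with index \<open>(a, ks)\<close> reappears in \<open>SJ\<close>
      under the index \<open>(a, map l ks)\<close>, where \<open>l\<close> lifts each entry of
      \<open>ks\<close> to the codensity liftings.\<close>
    have "reindex E B p (lam Xs) ` SI \<subseteq> SJ"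
    proof
      fix Q assume "Q \<in> reindex E B p (lam Xs) ` SI"
      then obtain a ks where i: "(a, ks) \<in> I"
        and Q: "Q = reindex E B p (lam Xs) (reindex E B p (f (a, ks)) (fobj \<Omega> a))"
        by (auto simp: SI_def)
      have a: "a \<in> Ob A" and ks_Hom: "ks \<in> Hom (power_cat N E) Ps (replicate N (fobj \<Omega> a))"
        using i by (auto simp: I_def)
      note ks = Hom_power_cat_replicateD[OF ks_Hom]
      \<comment> \<open>The lift is chosen per morphism rather than per position; equal entries have
        equal domains, so they may share it.\<close>
      have "\<forall>k \<in> set ks. \<exists>l. l \<in> Hom E (?F (Dom E k)) (fobj \<Omega> a) \<and>
          fmor p l = \<tau> a \<cdot>\<^bsub>B\<^esub> fmor F (fmor p k)"
        using F_lift[OF a ks(3)] by blast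
      from bchoice[OF this] obtain l where
        l: "\<And>k. k \<in> set ks \<Longrightarrow> l k \<in> Hom E (?F (Dom E k)) (fobj \<Omega> a)"
          "\<And>k. k \<in> set ks \<Longrightarrow> fmor p (l k) = \<tau> a \<cdot>\<^bsub>B\<^esub> fmor F (fmor p k)"
        by blast
      have j: "(a, map l ks) \<in> J"
        using Hom_power_catI[of ks l E "\<lambda>k. ?F (Dom E k)" "\<lambda>_. fobj \<Omega> a" N] l(1) ks(1,2) a
        by (simp add: J_def map_replicate_const comp_def)
      let ?O = "fobj p (fobj \<Omega> a)" and ?pks = "map (fmor p) ks"
      have pks: "?pks \<in> Hom (power_cat N B) Xs (replicate N ?O)"
        using pks_Hom[OF ks_Hom] by (simp add: Xs_def)
      have Tpks: "fmor T ?pks \<in> Hom B (fobj T Xs) (fobj T (replicate N ?O))"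
        using comp.oper.fmor_Hom[OF pks] .
      have Fpks: "map (fmor F) ?pks \<in>
          Hom (power_cat N B) (map (fobj F) Xs) (replicate N (fobj F ?O))"
        using Hom_power_catI[of ks "\<lambda>k. fmor F (fmor p k)" B "\<lambda>k. fobj F (fobj p (Dom E k))"
            "\<lambda>_. fobj F ?O" N] ks F.fmor_Hom fmor_Hom
        by (simp add: Xs_def map_replicate_const comp_def)
      have \<tau>s: "replicate N (\<tau> a) \<in>
          Hom (power_cat N B) (replicate N (fobj F ?O)) (replicate N ?O)"
        using Hom_power_catI[of "replicate N a" \<tau> B "\<lambda>_. fobj F ?O" "\<lambda>_. ?O" N] \<tau>_Hom[OF a]
        by (simp add: map_replicate_const)
      have lam_O: "lam (replicate N ?O) \<in>
          Hom B (fobj T (replicate N (fobj F ?O))) (fobj F (fobj T (replicate N ?O)))"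
        using lam_Hom[of "replicate N ?O"] fobj_Ob[OF \<Omega>_Ob[OF a]]
        by (simp add: power_cat_def set_replicate_conv_if)
      have F\<sigma>: "fmor F (\<sigma> a) \<in> Hom B (fobj F (fobj T (replicate N ?O))) (fobj F ?O)"
        using F.fmor_Hom[OF \<sigma>_Hom[OF a]] .
      have FTpks: "fmor F (fmor T ?pks) \<in> Hom B (fobj F (fobj T Xs)) (fobj F (fobj T (replicate N ?O)))"
        using F.fmor_Hom[OF Tpks] .
      have TFpks: "fmor T (map (fmor F) ?pks) \<in> Hom B Z (fobj T (replicate N (fobj F ?O)))"
        using comp.oper.fmor_Hom[OF Fpks] by (simp add: Z_def)
      have T\<tau>s: "fmor T (replicate N (\<tau> a)) \<in>
          Hom B (fobj T (replicate N (fobj F ?O))) (fobj T (replicate N ?O))"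
        using comp.oper.fmor_Hom[OF \<tau>s] .
      have nat: "fmor F (fmor T ?pks) \<cdot>\<^bsub>B\<^esub> lam Xs =
          lam (replicate N ?O) \<cdot>\<^bsub>B\<^esub> fmor T (map (fmor F) ?pks)"
        using comp.law.naturality[OF pks] by (simp add: functor_comp_def power_functor_def)
      \<comment> \<open>Composition of tuples is entrywise, and each entry is the morphism
        underlying the chosen lift; functoriality of \<open>T\<close> then merges the two
        factors.\<close>
      have "map2 (Comp B) (replicate N (\<tau> a)) (map (fmor F) ?pks) = map (fmor p) (map l ks)"
        using l(2) ks(1) by (auto simp: list_eq_iff_nth_eq)
      then have T\<tau>F: "fmor T (replicate N (\<tau> a)) \<cdot>\<^bsub>B\<^esub> fmor T (map (fmor F) ?pks) =
          fmor T (map (fmor p) (map l ks))"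
        using comp.oper.fmor_Comp[OF Fpks \<tau>s] by (simp add: power_cat_def)
      have "f (a, ks) \<cdot>\<^bsub>B\<^esub> lam Xs =
          (\<tau> a \<cdot>\<^bsub>B\<^esub> fmor F (\<sigma> a) \<cdot>\<^bsub>B\<^esub> fmor F (fmor T ?pks)) \<cdot>\<^bsub>B\<^esub> lam Xs"
        using F.fmor_Comp[OF Tpks \<sigma>_Hom[OF a]] by (simp add: f_def)
      also have "\<dots> = \<tau> a \<cdot>\<^bsub>B\<^esub> fmor F (\<sigma> a) \<cdot>\<^bsub>B\<^esub> fmor F (fmor T ?pks) \<cdot>\<^bsub>B\<^esub> lam Xs"
        using cod.Comp_assoc[OF lam cod.Comp_Hom[OF FTpks F\<sigma>] \<tau>_Hom[OF a]]
          cod.Comp_assoc[OF lam FTpks F\<sigma>] by simp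
      \<comment> \<open>Naturality of \<open>lam\<close> at the tuple of the \<open>fmor p k\<close>
        brings its component at the truth values next to \<open>fmor F (\<sigma> a)\<close>, which
        exposes the right-hand side of (1).\<close>
      also have "\<dots> = (\<tau> a \<cdot>\<^bsub>B\<^esub> fmor F (\<sigma> a) \<cdot>\<^bsub>B\<^esub> lam (replicate N ?O)) \<cdot>\<^bsub>B\<^esub> fmor T (map (fmor F) ?pks)"
        using cod.Comp_assoc[OF TFpks cod.Comp_Hom[OF lam_O F\<sigma>] \<tau>_Hom[OF a]]
          cod.Comp_assoc[OF TFpks lam_O F\<sigma>] nat by simp
      also have "\<dots> = (\<sigma> a \<cdot>\<^bsub>B\<^esub> fmor T (replicate N (\<tau> a))) \<cdot>\<^bsub>B\<^esub> fmor T (map (fmor F) ?pks)"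
        using cond1[OF a] \<O>_eq[OF a] by simp
      also have "\<dots> = g (a, map l ks)"
        using cod.Comp_assoc[OF TFpks T\<tau>s \<sigma>_Hom[OF a]] T\<tau>F by (simp add: g_def)
      finally have "Q = reindex E B p (g (a, map l ks)) (fobj \<Omega> a)"
        using Q reindex_comp[OF \<Omega>_Ob[OF a] lam f_Hom[OF i]] by simp
      then show "Q \<in> SJ" using j by (force simp: SJ_def)
    qed
    \<comment> \<open>Preservation of meets identifies the meet of the reindexed family with the
      reindexing of the meet of \<open>SI\<close>. An empty \<open>SI\<close> is included, its meet
      being the top of the fiber.\<close>
    from Inf_fiber_mono[OF Z SJ_carrier this]
    have "?T (map ?F Ps) \<sqsubseteq>\<^bsub>fiber E B p Z\<^esub> reindex E B p (lam Xs) (?F (?T Ps))"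
      using reindex_meet[OF lam SI_carrier] by (simp add: T_eq FT_eq)
    then show "?T (map ?F Ps) \<sqsubseteq>\<^bsub>fiber E B p (fobj T (map (\<lambda>P. fobj F (fobj p P)) Ps))\<^esub>
        reindex E B p (lam (map (fobj p) Ps)) (?F (?T Ps))"
      by (simp add: Z_def Xs_def comp_def)
  qed
qed

end
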